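(* Let $\boldsymbol X$ be a random element of $\mathcal H$ with $\mathbb E[\boldsymbol X]=0$ and $\boldsymbol Y$ a random vector in $\mathbb R^q$ with $\mathbb E[\|\boldsymbol X\|^2+\|\boldsymbol Y\|^2]<\infty$. Then: (i) $\mathrm{MDDO}(\boldsymbol X|\boldsymbol Y)=0$ if and only if $\mathbb E[\boldsymbol X|\boldsymbol Y]=0$ almost surely; (ii) for every bounded linear operator $T:\mathcal H\to\mathcal H$, $\mathrm{MDDO}(T^*\boldsymbol X|\boldsymbol Y)=T^*\,\mathrm{MDDO}(\boldsymbol X|\boldsymbol Y)\,T$, where $T^*$ is the adjoint of $T$.
   Context: $\mathcal H=L^2([0,1])$ with inner product $\langle f,g\rangle=\int_0^1 f g$ and norm $\|\cdot\|$. For $x,y\in\mathcal H$, $x\otimes y$ is the operator $z\mapsto\langle x,z\rangle y$. Martingale difference divergence operator: for $\boldsymbol s\in\mathbb R^q$ let $G_{\boldsymbol s}(t)=\mathrm{cov}(\boldsymbol X(t),e^{\mathrm i\langle \boldsymbol s,\boldsymbol Y\rangle})$ and $\mathrm{MDDO}(\boldsymbol X|\boldsymbol Y)=c_q^{-1}\int_{\mathbb R^q}\|\boldsymbol s\|^{-1-q}G_{\boldsymbol s}\otimes\overline{G_{\boldsymbol s}}\,d\boldsymbol s$ with $c_q=\pi^{(q+1)/2}/\Gamma((q+1)/2)$, integral in the principal value sense $\lim_{\varepsilon\to0^+}\int_{\varepsilon\le\|\boldsymbol s\|\le\varepsilon^{-1}}$. The same definition applies to any mean-zero random element (e.g. $T^*\boldsymbol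 X$) in place of $\boldsymbol X$. *)

theory Defs
  imports "HOL-Probability.Probability"
begin

text \<open>The Hilbert space H is modelled by a type 'h of class real_inner / banach /
second_countable_topology, together with the hypothesis that 'h is unitarily
isomorphic to L2([0,1]) (inner product = integral of the product over [0,1]).\<close>

definition L2_01_model :: "('h::real_inner \<Rightarrow> real \<Rightarrow> real) \<Rightarrow> bool" where
  "L2_01_model U \<longleftrightarrow>
     (\<forall>x. U x \<in> borel_measurable lborel \<and> set_integrable lborel {0..1} (\<lambda>t. (U x t)^2)) \<and>
     (\<forall>x y. x \<bullet> y = (LINT t:{0..1}|lborel. U x t * U y t)) \<and>
     (\<forall>f. f \<in> borel_measurable lborel \<and> set_integrable lborel {0..1} (\<lambda>t. (f t)^2) \<longrightarrow>
          (\<exists>x. AE t in lborel. t \<in> {0..1} \<longrightarrow> U x t = f t))"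

text \<open>Elements of the complexification of H are pairs (real part, imaginary part).\<close>

text \<open>Covariance of an H-valued random element X with a complex random variable B:
  cov(X,B) = E[(X - E X) * conj(B - E B)], written out in real and imaginary parts.\<close>
definition cov_HC :: "'a measure \<Rightarrow> ('a \<Rightarrow> 'h::{banach,second_countable_topology})
    \<Rightarrow> ('a \<Rightarrow> complex) \<Rightarrow> 'h \<times> 'h" where
  "cov_HC M X B =
     (let mX = integral\<^sup>L M X; mB = integral\<^sup>L M B in
      (integral\<^sup>L M (\<lambda>\<omega>. Re (B \<omega> - mB) *\<^sub>R (X \<omega> - mX)),
       integral\<^sup>L M (\<lambda>\<omega>. (- Im (B \<omega> - mB)) *\<^sub>R (X \<omega> - mX))))"

definition G_fun :: "'a measure \<Rightarrow> ('a \<Rightarrow> 'h::{banach,second_countable_topology})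
    \<Rightarrow> ('a \<Rightarrow> 'y::euclidean_space) \<Rightarrow> 'y \<Rightarrow> 'h \<times> 'h" where
  "G_fun M X Y s = cov_HC M X (\<lambda>\<omega>. cis (s \<bullet> Y \<omega>))"

text \<open>Tensor x \<otimes> y : z \<mapsto> <x,z> y on the complexification, with the bilinear
  extension of the inner product, applied to a real element z of H.\<close>
definition tensor_HC :: "'h::real_inner \<times> 'h \<Rightarrow> 'h \<times> 'h \<Rightarrow> 'h \<Rightarrow> 'h \<times> 'h" where
  "tensor_HC x y z =
     (let p = fst x \<bullet> z; r = snd x \<bullet> z in
      (p *\<^sub>R fst y - r *\<^sub>R snd y, p *\<^sub>R snd y + r *\<^sub>R fst y))"

definition conj_HC :: "'h::real_vector \<times> 'h \<Rightarrow> 'h \<times> 'h" where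
  "conj_HC x = (fst x, - snd x)"

definition c_const :: "nat \<Rightarrow> real" where
  "c_const q = pi powr ((real q + 1) / 2) / Gamma ((real q + 1) / 2)"

text \<open>MDDO(X|Y), applied to z \<in> H (strong principal value sense), with values in the
  complexification of H.\<close>
definition MDDO :: "'a measure \<Rightarrow> ('a \<Rightarrow> 'h::{real_inner,banach,second_countable_topology})
    \<Rightarrow> ('a \<Rightarrow> 'y::euclidean_space) \<Rightarrow> 'h \<Rightarrow> 'h \<times> 'h" where
  "MDDO M X Y z =
     inverse (c_const DIM('y)) *\<^sub>R
       Lim (at_right (0::real))
         (\<lambda>\<epsilon>. LINT s:{s. \<epsilon> \<le> norm s \<and> norm s \<le> inverse \<epsilon>}|lborel.
                 (norm s powr (- 1 - real DIM('y))) *\<^sub>R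
                   tensor_HC (G_fun M X Y s) (conj_HC (G_fun M X Y s)) z)"

definition has_cond_exp :: "'a measure \<Rightarrow> 'a measure \<Rightarrow> ('a \<Rightarrow> 'h::{banach,second_countable_topology})
    \<Rightarrow> ('a \<Rightarrow> 'h) \<Rightarrow> bool" where
  "has_cond_exp M F X Z \<longleftrightarrow>
     Z \<in> borel_measurable F \<and> integrable M Z \<and>
     (\<forall>A\<in>sets F. (LINT \<omega>:A|M. X \<omega>) = (LINT \<omega>:A|M. Z \<omega>))"

abbreviation sigma_rv :: "'a measure \<Rightarrow> ('a \<Rightarrow> 'y::topological_space) \<Rightarrow> 'a measure" where
  "sigma_rv M Y \<equiv> vimage_algebra (space M) Y borel"

text \<open>E[X|Y] = 0 almost surely: some (equivalently, every) version of E[X|Y] vanishes a.s.\<close>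
definition cond_exp_zero_ae :: "'a measure \<Rightarrow> ('a \<Rightarrow> 'h::{banach,second_countable_topology})
    \<Rightarrow> ('a \<Rightarrow> 'y::topological_space) \<Rightarrow> bool" where
  "cond_exp_zero_ae M X Y \<longleftrightarrow>
     (\<exists>Z. has_cond_exp M (sigma_rv M Y) X Z \<and> (AE \<omega> in M. Z \<omega> = 0))"

end

theory Submission
  imports Defs
begin

text \<open>Since \<open>E X = 0\<close>, \<open>G_s\<close> is dominated by a multiple of \<open>min 1 \<bar>s\<bar>\<close>, so the integral defining
the MDDO converges absolutely and the principal value is an ordinary Bochner integral. Part (ii)
then amounts to pulling a bounded operator through integrals. For part (i), testing the MDDO against
\<open>z\<close> gives the integral of \<open>\<bar>s\<bar>\<^bsup>-1-q\<^esup> \<bar>\<langle>G_s, z\<rangle>\<bar>\<^sup>2\<close>; if it vanishes then, by continuity in \<open>s\<close>,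
\<open>E[\<langle>X, z\<rangle> exp(i \<langle>s, Y\<rangle>)] = 0\<close> for all \<open>s\<close>. Fourier uniqueness, reduced one coordinate of \<open>Y\<close> at a
time to Levy's one-dimensional theorem, yields \<open>E[\<langle>X, z\<rangle> 1_A(Y)] = 0\<close> for all Borel \<open>A\<close>.\<close>

subsection \<open>Adjoints in Hilbert space\<close>

lemma riesz_representation_exists:
  fixes f :: "'h::{real_inner,banach} \<Rightarrow> real"
  assumes "bounded_linear f"
  shows "\<exists>y. \<forall>x. f x = x \<bullet> y"
  \<comment> \<open>The representing vector minimizes \<open>J x = \<bar>x\<bar>\<^sup>2 - 2 f x\<close>; minimizing sequences are Cauchy by the
    parallelogram law.\<close>
proof -
  interpret f: bounded_linear f by fact
  define J where "J x = (norm x)\<^sup>2 - 2 * f x" for x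
  obtain K where K: "\<And>x. \<bar>f x\<bar> \<le> norm x * K"
    using f.bounded by auto
  have lower: "- K\<^sup>2 \<le> J x" for x
  proof -
    have "0 \<le> (norm x - K)\<^sup>2" by simp
    then show ?thesis using K[of x] unfolding J_def power2_eq_square by (simp add: algebra_simps)
  qed
  define m where "m = (INF x. J x)"
  have bdd: "bdd_below (range J)" using lower by (auto intro!: bdd_belowI)
  have m_le: "m \<le> J x" for x unfolding m_def by (rule cINF_lower[OF bdd]) simp
  have "\<exists>x. J x < m + inverse (real (Suc n))" for n
    using cINF_less_iff[OF _ bdd, of "m + inverse (real (Suc n))"] by (simp add: m_def)
  then obtain u where u: "\<And>n. J (u n) < m + inverse (real (Suc n))" by metis
  have parallelogram: "(norm (x - y))\<^sup>2 \<le> 2 * J x + 2 * J y - 4 * m" for x y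
  proof -
    have "J x + J y = 2 * J ((1/2) *\<^sub>R (x + y)) + (norm (x - y))\<^sup>2 / 2"
      unfolding J_def power2_norm_eq_inner
      by (simp add: f.scaleR f.add inner_simps inner_commute field_simps)
    moreover have "m \<le> J ((1/2) *\<^sub>R (x + y))" by (rule m_le)
    ultimately show ?thesis by (simp add: algebra_simps)
  qed
  have "Cauchy u"
  proof (rule metric_CauchyI)
    fix e :: real assume e: "0 < e"
    \<comment> \<open>Two excesses over \<open>m\<close>, each below e^2/4 and each doubled by
      \<open>parallelogram\<close>, add up to less than e^2.\<close>
    then obtain N where N: "inverse (real (Suc N)) < e\<^sup>2 / 4"
      using reals_Archimedean[of "e\<^sup>2 / 4"] by auto
    have "dist (u i) (u j) < e" if "i \<ge> N" "j \<ge> N" for i j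
    proof -
      have small: "J (u k) < m + e\<^sup>2 / 4" if "k \<ge> N" for k
      proof -
        have "inverse (real (Suc k)) \<le> inverse (real (Suc N))" using that by (simp add: field_simps)
        then show ?thesis using u[of k] N by linarith
      qed
      have "(norm (u i - u j))\<^sup>2 < e\<^sup>2"
        using parallelogram[of "u i" "u j"] small[OF that(1)] small[OF that(2)] by linarith
      then show ?thesis using e by (simp add: dist_norm power2_less_imp_less)
    qed
    then show "\<exists>N. \<forall>i\<ge>N. \<forall>j\<ge>N. dist (u i) (u j) < e" by blast
  qed
  then obtain y where y: "u \<longlonglongrightarrow> y" by (auto simp: Cauchy_convergent_iff convergent_def)
  have "(\<lambda>n. J (u n)) \<longlonglongrightarrow> J y"
    unfolding J_def by (intro tendsto_intros f.tendsto y)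
  moreover have "(\<lambda>n. m + inverse (real (Suc n))) \<longlonglongrightarrow> m + 0"
    by (intro tendsto_intros LIMSEQ_inverse_real_of_nat)
  ultimately have "J y \<le> m"
    using LIMSEQ_le[of "\<lambda>n. J (u n)" "J y" _ "m + 0"] u by (auto intro: less_imp_le)
  have "f x = x \<bullet> y" for x
  proof -
    \<comment> \<open>First variation: moving from the minimizer \<open>y\<close> in the direction
      \<open>x\<close> cannot decrease \<open>J\<close>.\<close>
    have quad: "0 \<le> t\<^sup>2 * (norm x)\<^sup>2 + 2 * t * (x \<bullet> y - f x)" for t
    proof -
      have "J (y + t *\<^sub>R x) = J y + t\<^sup>2 * (norm x)\<^sup>2 + 2 * t * (x \<bullet> y - f x)"
        unfolding J_def power2_norm_eq_inner
        by (simp add: f.scaleR f.add inner_simps inner_commute algebra_simps power2_eq_square)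
      then show ?thesis using m_le[of "y + t *\<^sub>R x"] \<open>J y \<le> m\<close> by linarith
    qed
    define d where "d = x \<bullet> y - f x"
    show ?thesis
    proof (cases "x = 0")
      case True then show ?thesis by (simp add: f.zero)
    next
      case False
      then have n: "(norm x)\<^sup>2 > 0" by simp
      \<comment> \<open>The value of \<open>t\<close> that minimizes the quadratic turns
        \<open>quad\<close> into -d^2 / |x|^2 >= 0, which forces d = 0.\<close>
      have "0 \<le> (- d / (norm x)\<^sup>2)\<^sup>2 * (norm x)\<^sup>2 + 2 * (- d / (norm x)\<^sup>2) * d"
        using quad[of "- d / (norm x)\<^sup>2"] unfolding d_def .
      also have "\<dots> = - d\<^sup>2 / (norm x)\<^sup>2"
        using n by (simp add: power2_eq_square field_simps)
      finally have "d\<^sup>2 \<le> 0" using n by (auto simp: divide_le_0_iff)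
      then show ?thesis by (simp add: d_def)
    qed
  qed
  then show ?thesis by blast
qed

text \<open>\<open>adjoint\<close> is defined by a choice operator, so its characteristic identity
  holds only once some adjoint is known to exist. Riesz representation of the functional
  \<open>T x \<bullet> y\<close> in \<open>x\<close>, for each \<open>y\<close>, supplies
  one.\<close>

lemma bounded_linear_adjoint_inner:
  fixes T :: "'h::{real_inner,banach} \<Rightarrow> 'k::real_inner"
  assumes "bounded_linear T"
  shows "T x \<bullet> y = x \<bullet> adjoint T y"
proof -
  have "\<exists>w. \<forall>x. T x \<bullet> y = x \<bullet> w" for y
    by (rule riesz_representation_exists)
       (rule bounded_linear_compose[OF bounded_linear_inner_left assms])
  then have "\<exists>S. \<forall>x y. T x \<bullet> y = x \<bullet> S y" by metis
  then have "\<forall>x y. T x \<bullet> y = x \<bullet> adjoint T y"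
    unfolding adjoint_def by (rule someI_ex)
  then show ?thesis by blast
qed

text \<open>Linearity is checked by testing against all vectors. A bound \<open>K\<close> for
  \<open>T\<close> is inherited because the squared norm of \<open>adjoint T y\<close> equals
  \<open>T (adjoint T y) \<bullet> y\<close>; one factor of that norm is then cancelled.\<close>

lemma bounded_linear_adjoint:
  fixes T :: "'h::{real_inner,banach} \<Rightarrow> 'k::real_inner"
  assumes T: "bounded_linear T"
  shows "bounded_linear (adjoint T)"
proof -
  note adj = bounded_linear_adjoint_inner[OF T]
  obtain K where "K \<ge> 0" and K: "\<And>x. norm (T x) \<le> norm x * K"
    using bounded_linear.nonneg_bounded[OF T] by blast
  show ?thesis
  proof (rule bounded_linear_intro)
    show "adjoint T (x + y) = adjoint T x + adjoint T y" for x y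
      by (subst vector_eq_ldot[symmetric]) (simp add: inner_simps flip: adj)
    show "adjoint T (r *\<^sub>R x) = r *\<^sub>R adjoint T x" for r x
      by (subst vector_eq_ldot[symmetric]) (simp add: inner_simps flip: adj)
    show "norm (adjoint T y) \<le> norm y * K" for y
    proof (cases "adjoint T y = 0")
      case True
      then show ?thesis using \<open>K \<ge> 0\<close> by simp
    next
      case False
      have "norm (adjoint T y) * norm (adjoint T y) = T (adjoint T y) \<bullet> y"
        by (simp add: adj flip: power2_norm_eq_inner power2_eq_square)
      also have "\<dots> \<le> norm (T (adjoint T y)) * norm y" by (rule norm_cauchy_schwarz)
      also have "\<dots> \<le> (norm (adjoint T y) * K) * norm y" by (intro mult_right_mono K) simp
      finally show ?thesis using False by (simp add: ac_simps)
    qed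
  qed
qed

subsection \<open>Fourier uniqueness\<close>

lemma borel_measurable_cis [measurable]: "cis \<in> borel_measurable borel"
  unfolding cis_conv_exp by measurable

lemma fourier_zero_imp_integral_zero_real:
  fixes \<xi> Y :: "'a \<Rightarrow> real"
  assumes int: "integrable M \<xi>" and [measurable]: "Y \<in> borel_measurable M"
    and zero: "\<And>t. (LINT \<omega>|M. \<xi> \<omega> *\<^sub>R cis (t * Y \<omega>)) = 0"
    and A[measurable]: "A \<in> sets borel"
  shows "(LINT \<omega>|M. \<xi> \<omega> * indicator A (Y \<omega>)) = 0"
proof -
  have [measurable]: "\<xi> \<in> borel_measurable M" using int by auto
  \<comment> \<open>The normalized positive and negative parts of \<open>\<xi>\<close> push forward along \<open>Y\<close> to probability measures
    with the same characteristic function.\<close>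
  define p where "p \<omega> = max (\<xi> \<omega>) 0" for \<omega>
  define n where "n \<omega> = max (- \<xi> \<omega>) 0" for \<omega>
  have \<xi>_eq: "\<xi> \<omega> = p \<omega> - n \<omega>" for \<omega> by (auto simp: p_def n_def)
  have nonneg: "p \<omega> \<ge> 0" "n \<omega> \<ge> 0" for \<omega> by (auto simp: p_def n_def)
  have ip: "integrable M p" and in': "integrable M n"
    unfolding p_def n_def using int by auto
  have [measurable]: "p \<in> borel_measurable M" "n \<in> borel_measurable M" using ip in' by auto
  have icis: "integrable M (\<lambda>\<omega>. f \<omega> *\<^sub>R cis (t * Y \<omega>))" if "integrable M f" for f :: "'a \<Rightarrow> real" and t
    using that by (intro Bochner_Integration.integrable_bound[OF that]) auto
  have iind: "integrable M (\<lambda>\<omega>. f \<omega> * indicator A (Y \<omega>))" if "integrable M f" for f :: "'a \<Rightarrow> real"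
    using that by (intro Bochner_Integration.integrable_bound[OF that]) (auto simp: indicator_def)
  have cis_eq: "(LINT \<omega>|M. p \<omega> *\<^sub>R cis (t * Y \<omega>)) = (LINT \<omega>|M. n \<omega> *\<^sub>R cis (t * Y \<omega>))" for t
    using zero[of t] icis[OF ip] icis[OF in'] unfolding \<xi>_eq by (simp add: scaleR_diff_left)
  define m where "m = integral\<^sup>L M p"
  \<comment> \<open>Frequency 0 shows that \<open>p\<close> and \<open>n\<close> have the same total
    mass, so one constant \<open>m\<close> normalizes both.\<close>
  have "(LINT \<omega>|M. \<xi> \<omega> *\<^sub>R (1::complex)) = 0" using zero[of 0] by simp
  then have "of_real (integral\<^sup>L M \<xi>) = (0::complex)"
    using int by (simp add: scaleR_conv_of_real)
  then have m_n: "m = integral\<^sup>L M n"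
    using ip in' unfolding \<xi>_eq m_def by simp
  have "m \<ge> 0" unfolding m_def using nonneg by simp
  show ?thesis
  proof (cases "m = 0")
    \<comment> \<open>Normalization is impossible here, but both parts vanish almost
      everywhere.\<close>
    case True
    have "AE \<omega> in M. p \<omega> = 0" "AE \<omega> in M. n \<omega> = 0"
      using True integral_nonneg_eq_0_iff_AE[OF ip] integral_nonneg_eq_0_iff_AE[OF in'] nonneg
      unfolding m_def m_n[unfolded m_def] by (auto simp: m_def m_n)
    then have "AE \<omega> in M. \<xi> \<omega> * indicator A (Y \<omega>) = 0" by eventually_elim (simp add: \<xi>_eq)
    then show ?thesis by (rule integral_eq_zero_AE)
  next
    case False
    with \<open>m \<ge> 0\<close> have "m > 0" by simp
    define P where "P f = distr (density M (\<lambda>\<omega>. f \<omega> / m)) borel Y" for f :: "'a \<Rightarrow> real"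
    have P_integral: "integral\<^sup>L (P f) g = (LINT \<omega>|M. (f \<omega> / m) *\<^sub>R g (Y \<omega>))"
      if [measurable]: "f \<in> borel_measurable M" "g \<in> borel_measurable borel" and "\<And>\<omega>. f \<omega> \<ge> 0"
      for f and g :: "real \<Rightarrow> 'b::{banach,second_countable_topology}"
      unfolding P_def using that \<open>m > 0\<close> by (simp add: integral_distr integral_density)
    have P_dist: "real_distribution (P f)"
      if f: "integrable M f" "\<And>\<omega>. f \<omega> \<ge> 0" "integral\<^sup>L M f = m" for f
    proof -
      have [measurable]: "f \<in> borel_measurable M" using f by auto
      have "emeasure (density M (\<lambda>\<omega>. f \<omega> / m)) (space M) = (\<integral>\<^sup>+\<omega>. ennreal (f \<omega> / m) \<partial>M)"
        by (simp add: emeasure_density cong: nn_integral_cong)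
      also have "\<dots> = ennreal (LINT \<omega>|M. f \<omega> / m)"
        using f \<open>m > 0\<close> by (intro nn_integral_eq_integral) auto
      also have "\<dots> = 1" using f \<open>m > 0\<close> by simp
      finally have "prob_space (density M (\<lambda>\<omega>. f \<omega> / m))" by (intro prob_spaceI) simp
      then have "prob_space (P f)" unfolding P_def by (rule prob_space.prob_space_distr) simp
      then show ?thesis
        by (intro real_distribution.intro real_distribution_axioms.intro) (auto simp: P_def)
    qed
    have char_P: "char (P f) t = (LINT \<omega>|M. f \<omega> *\<^sub>R cis (t * Y \<omega>)) / m"
      if "integrable M f" "\<And>\<omega>. f \<omega> \<ge> 0" for f t
    proof -
      have "char (P f) t = (LINT \<omega>|M. (f \<omega> / m) *\<^sub>R cis (t * Y \<omega>))"
        unfolding char_def using that by (subst P_integral) (auto simp: cis_conv_exp)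
      also have "\<dots> = (LINT \<omega>|M. inverse m *\<^sub>R (f \<omega> *\<^sub>R cis (t * Y \<omega>)))"
        by (simp add: field_simps)
      also have "\<dots> = (LINT \<omega>|M. f \<omega> *\<^sub>R cis (t * Y \<omega>)) / m"
        by (simp add: scaleR_conv_of_real field_simps)
      finally show ?thesis .
    qed
    have "char (P p) t = char (P n) t" for t
      using cis_eq[of t] by (simp add: char_P ip in' nonneg)
    then have "P p = P n"
      by (intro Levy_uniqueness P_dist ip in' nonneg ext) (auto simp: m_def[symmetric] m_n[symmetric])
    then have "integral\<^sup>L (P p) (indicator A) = (integral\<^sup>L (P n) (indicator A) :: real)" by simp
    then have "(LINT \<omega>|M. p \<omega> / m * indicator A (Y \<omega>)) = (LINT \<omega>|M. n \<omega> / m * indicator A (Y \<omega>))"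
      by (simp add: P_integral nonneg del: Bochner_Integration.integral_indicator)
    then have "(LINT \<omega>|M. p \<omega> * indicator A (Y \<omega>)) = (LINT \<omega>|M. n \<omega> * indicator A (Y \<omega>))"
      using \<open>m > 0\<close> by simp
    then show ?thesis
      using iind[OF ip] iind[OF in'] unfolding \<xi>_eq by (simp add: left_diff_distrib)
  qed
qed

lemma fourier_zero_imp_integral_zero_complex:
  fixes \<xi> :: "'a \<Rightarrow> complex" and Y :: "'a \<Rightarrow> real"
  assumes int: "integrable M \<xi>" and [measurable]: "Y \<in> borel_measurable M"
    and zero: "\<And>t. (LINT \<omega>|M. \<xi> \<omega> * cis (t * Y \<omega>)) = 0"
    and A: "A \<in> sets borel"
  shows "(LINT \<omega>|M. \<xi> \<omega> * indicator A (Y \<omega>)) = 0"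
proof -
  have [measurable]: "\<xi> \<in> borel_measurable M" using int by auto
  have icis: "integrable M (\<lambda>\<omega>. f \<omega> * cis (t * Y \<omega>))" if "integrable M f" for f t
    using that by (intro Bochner_Integration.integrable_bound[OF that]) (auto simp: norm_mult)
  \<comment> \<open>The hypothesis is stable under \<open>t \<mapsto> -t\<close>, hence passes to the conjugate of \<open>\<xi>\<close> and so to its real
    and imaginary parts.\<close>
  have conj_zero: "(LINT \<omega>|M. cnj (\<xi> \<omega>) * cis (t * Y \<omega>)) = 0" for t
  proof -
    have "(LINT \<omega>|M. cnj (\<xi> \<omega>) * cis (t * Y \<omega>)) = (LINT \<omega>|M. cnj (\<xi> \<omega> * cis ((-t) * Y \<omega>)))"
      by (simp add: cis_cnj)
    also have "\<dots> = cnj (LINT \<omega>|M. \<xi> \<omega> * cis ((-t) * Y \<omega>))"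
      by (rule Bochner_Integration.integral_cnj)
    finally show ?thesis using zero[of "-t"] by simp
  qed
  have int_cnj: "integrable M (\<lambda>\<omega>. cnj (\<xi> \<omega>))" using int by simp
  have Re_zero: "(LINT \<omega>|M. Re (\<xi> \<omega>) *\<^sub>R cis (t * Y \<omega>)) = 0" for t
  proof -
    have eq: "Re z *\<^sub>R w = (z * w + cnj z * w) / 2" for z w :: complex
      by (simp add: complex_eq_iff algebra_simps)
    show ?thesis unfolding eq
      using icis[OF int, of t] icis[OF int_cnj, of t] zero[of t] conj_zero[of t] by simp
  qed
  have Im_zero: "(LINT \<omega>|M. Im (\<xi> \<omega>) *\<^sub>R cis (t * Y \<omega>)) = 0" for t
  proof -
    have eq: "Im z *\<^sub>R w = - (\<i> / 2) * (z * w - cnj z * w)" for z w :: complex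
      by (simp add: complex_eq_iff field_simps)
    show ?thesis unfolding eq
      using icis[OF int, of t] icis[OF int_cnj, of t] zero[of t] conj_zero[of t] by simp
  qed
  have "integrable M (\<lambda>\<omega>. \<xi> \<omega> * indicator A (Y \<omega>))"
    using A by (intro Bochner_Integration.integrable_bound[OF int]) (auto simp: indicator_def)
  moreover have "(LINT \<omega>|M. Re (\<xi> \<omega>) * indicator A (Y \<omega>)) = 0"
    "(LINT \<omega>|M. Im (\<xi> \<omega>) * indicator A (Y \<omega>)) = 0"
    using int A by (auto intro!: fourier_zero_imp_integral_zero_real Re_zero Im_zero)
  moreover have "Re (z * indicator A y) = Re z * indicator A y"
    "Im (z * indicator A y) = Im z * indicator A y" for z and y :: real
    by (auto simp: indicator_def)
  ultimately show ?thesis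
    by (simp add: complex_eq_iff flip: integral_Re integral_Im)
qed

text \<open>Induction on the coordinates, each step trading one exponential for an indicator by the
  one-dimensional result. The exponentials of the other coordinates are absorbed into the weight
  meanwhile, which is why \<open>\<xi>\<close> is complex; the new indicator is absorbed too, which
  is why \<open>\<xi>\<close> varies in the induction.\<close>

lemma fourier_zero_imp_integral_zero_prod:
  fixes \<xi> :: "'a \<Rightarrow> complex" and Y :: "'i \<Rightarrow> 'a \<Rightarrow> real"
  assumes "finite J" and "integrable M \<xi>" and "\<And>j. j \<in> J \<Longrightarrow> Y j \<in> borel_measurable M"
    and "\<And>t. (LINT \<omega>|M. \<xi> \<omega> * (\<Prod>j\<in>J. cis (t j * Y j \<omega>))) = 0"
    and "\<And>j. j \<in> J \<Longrightarrow> A j \<in> sets borel"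
  shows "(LINT \<omega>|M. \<xi> \<omega> * (\<Prod>j\<in>J. indicator (A j) (Y j \<omega>))) = 0"
  using assms
proof (induction J arbitrary: \<xi> rule: finite_induct)
  case empty
  then show ?case by simp
next
  case (insert k J)
  have [measurable]: "\<xi> \<in> borel_measurable M" "Y k \<in> borel_measurable M" "A k \<in> sets borel"
    "\<And>j. j \<in> J \<Longrightarrow> Y j \<in> borel_measurable M"
    using insert.prems by auto
  have "(LINT \<omega>|M. \<xi> \<omega> * indicator (A k) (Y k \<omega>) * (\<Prod>j\<in>J. cis (t j * Y j \<omega>))) = 0" for t
  proof -
    have "(LINT \<omega>|M. \<xi> \<omega> * (\<Prod>j\<in>J. cis (t j * Y j \<omega>)) * indicator (A k) (Y k \<omega>)) = 0"
    proof (rule fourier_zero_imp_integral_zero_complex)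
      show "integrable M (\<lambda>\<omega>. \<xi> \<omega> * (\<Prod>j\<in>J. cis (t j * Y j \<omega>)))"
        by (rule Bochner_Integration.integrable_bound[OF insert.prems(1)])
           (auto simp: norm_mult simp flip: prod_norm)
      show "(LINT \<omega>|M. \<xi> \<omega> * (\<Prod>j\<in>J. cis (t j * Y j \<omega>)) * cis (u * Y k \<omega>)) = 0" for u
      proof -
        \<comment> \<open>Since \<open>k\<close> is not in \<open>J\<close>, its frequency
          \<open>u\<close> can be varied with the other frequencies fixed.\<close>
        have "(\<Prod>j\<in>J. cis ((t(k := u)) j * Y j \<omega>)) = (\<Prod>j\<in>J. cis (t j * Y j \<omega>))" for \<omega>
          using insert.hyps by (intro prod.cong) auto
        then show ?thesis
          using insert.prems(3)[of "t(k := u)"] insert.hyps by (simp add: ac_simps)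
      qed
    qed auto
    then show ?thesis by (simp add: ac_simps)
  qed
  moreover have "integrable M (\<lambda>\<omega>. \<xi> \<omega> * indicator (A k) (Y k \<omega>))"
    by (rule Bochner_Integration.integrable_bound[OF insert.prems(1)]) (auto simp: indicator_def)
  ultimately have "(LINT \<omega>|M. \<xi> \<omega> * indicator (A k) (Y k \<omega>) * (\<Prod>j\<in>J. indicator (A j) (Y j \<omega>))) = 0"
    using insert.prems by (intro insert.IH) auto
  then show ?case using insert.hyps by (simp add: ac_simps)
qed

text \<open>An open box is a product of intervals, so its indicator factors over the coordinates and
  the product version applies. Boxes form an intersection-stable generator of the Borel sets, and a
  Dynkin argument extends the identity.\<close>

lemma fourier_zero_imp_integral_zero:
  fixes \<xi> :: "'a \<Rightarrow> real" and Y :: "'a \<Rightarrow> 'y::euclidean_space"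
  assumes int: "integrable M \<xi>" and [measurable]: "Y \<in> borel_measurable M"
    and zero: "\<And>s. (LINT \<omega>|M. \<xi> \<omega> *\<^sub>R cis (s \<bullet> Y \<omega>)) = 0"
    and A: "A \<in> sets borel"
  shows "(LINT \<omega>|M. \<xi> \<omega> * indicator A (Y \<omega>)) = 0"
proof -
  have [measurable]: "\<xi> \<in> borel_measurable M" using int by auto
  have iind: "integrable M (\<lambda>\<omega>. \<xi> \<omega> * indicator A (Y \<omega>))" if [measurable]: "A \<in> sets borel" for A
    by (rule Bochner_Integration.integrable_bound[OF int]) (auto simp: indicator_def)
  \<comment> \<open>The case s = 0; it is what the complement step of the Dynkin argument
    needs.\<close>
  have total: "integral\<^sup>L M \<xi> = 0"
  proof -
    have "of_real (integral\<^sup>L M \<xi>) = (0::complex)"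
      using zero[of 0] int by (simp add: scaleR_conv_of_real)
    then show ?thesis by simp
  qed
  have box_zero: "(LINT \<omega>|M. \<xi> \<omega> * indicator (box a b) (Y \<omega>)) = 0" for a b :: 'y
  proof -
    have "(LINT \<omega>|M. of_real (\<xi> \<omega>) * (\<Prod>i\<in>Basis. indicator {a \<bullet> i <..< b \<bullet> i} (Y \<omega> \<bullet> i))) = (0::complex)"
    proof (rule fourier_zero_imp_integral_zero_prod)
      fix t :: "'y \<Rightarrow> real"
      have cis_sum: "cis (\<Sum>i\<in>I. f i) = (\<Prod>i\<in>I. cis (f i))" if "finite I" for I and f :: "'y \<Rightarrow> real"
        using that by induction (auto simp: cis_mult[symmetric])
      have "(\<Sum>i\<in>Basis. t i *\<^sub>R i) \<bullet> y = (\<Sum>i\<in>Basis. t i * (y \<bullet> i))" for y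
        by (simp add: inner_sum_right inner_commute[of _ y])
      then show "(LINT \<omega>|M. of_real (\<xi> \<omega>) * (\<Prod>i\<in>Basis. cis (t i * (Y \<omega> \<bullet> i)))) = 0"
        using zero[of "\<Sum>i\<in>Basis. t i *\<^sub>R i"] by (simp add: cis_sum scaleR_conv_of_real)
    qed (use int in auto)
    moreover have "(\<Prod>i\<in>Basis. indicator {a \<bullet> i <..< b \<bullet> i} (y \<bullet> i)) = (of_real (indicator (box a b) y) :: complex)" for y
      by (auto simp: indicator_def mem_box prod_zero_iff)
    ultimately have "of_real (LINT \<omega>|M. \<xi> \<omega> * indicator (box a b) (Y \<omega>)) = (0::complex)"
      by (simp flip: integral_complex_of_real)
    then show ?thesis by simp
  qed
  have "Int_stable (range (\<lambda>(a, b). box a b :: 'y set))"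
    unfolding Int_stable_def by (auto simp: box_Int_box)
  moreover have "range (\<lambda>(a, b). box a b :: 'y set) \<subseteq> Pow UNIV" by simp
  moreover have "A \<in> sigma_sets UNIV (range (\<lambda>(a, b). box a b :: 'y set))"
    using A by (simp add: borel_eq_box)
  ultimately show ?thesis
  proof (induction rule: sigma_sets_induct_disjoint[consumes 3])
    case (compl B)
    then have B[measurable]: "B \<in> sets borel" by (simp add: borel_eq_box)
    have "\<xi> \<omega> * indicator (UNIV - B) (Y \<omega>) = \<xi> \<omega> - \<xi> \<omega> * indicator B (Y \<omega>)" for \<omega>
      by (auto simp: indicator_def)
    then show ?case using compl total int iind[OF B] by simp
  next
    case (union B)
    then have B[measurable]: "B i \<in> sets borel" for i by (auto simp: borel_eq_box)
    \<comment> \<open>As \<open>\<xi>\<close> is signed, countable additivity is obtained from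
      finite disjoint unions by dominated convergence, with majorant |\<xi>|.\<close>
    have "(\<lambda>i. LINT \<omega>|M. \<xi> \<omega> * indicator (\<Union>j<i. B j) (Y \<omega>)) \<longlonglongrightarrow> (LINT \<omega>|M. \<xi> \<omega> * indicator (\<Union>i. B i) (Y \<omega>))"
    proof (rule integral_dominated_convergence)
      show "integrable M (\<lambda>\<omega>. \<bar>\<xi> \<omega>\<bar>)" using int by simp
      show "AE \<omega> in M. (\<lambda>i. \<xi> \<omega> * indicator (\<Union>j<i. B j) (Y \<omega>)) \<longlonglongrightarrow> \<xi> \<omega> * indicator (\<Union>i. B i) (Y \<omega>)"
        by (intro AE_I2 tendsto_mult tendsto_const LIMSEQ_indicator_UN)
    qed (auto simp: indicator_def)
    moreover have "(LINT \<omega>|M. \<xi> \<omega> * indicator (\<Union>j<i. B j) (Y \<omega>)) = 0" for i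
    proof -
      have "indicator (\<Union>j<i. B j) y = (\<Sum>j<i. indicator (B j) y :: real)" for y
        using union.hyps(1) by (intro indicator_UN_disjoint) (auto simp: disjoint_family_on_def)
      then have "(LINT \<omega>|M. \<xi> \<omega> * indicator (\<Union>j<i. B j) (Y \<omega>)) = (LINT \<omega>|M. (\<Sum>j<i. \<xi> \<omega> * indicator (B j) (Y \<omega>)))"
        by (simp only: sum_distrib_left)
      also have "\<dots> = (\<Sum>j<i. LINT \<omega>|M. \<xi> \<omega> * indicator (B j) (Y \<omega>))"
        by (rule Bochner_Integration.integral_sum) (rule iind[OF B])
      finally show ?thesis using union.IH by simp
    qed
    ultimately show ?case by (simp add: LIMSEQ_const_iff)
  qed (use box_zero in auto)
qed

subsection \<open>Integrability of the weight\<close>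

text \<open>Locates a dyadic shell; it is applied to |s| outside the unit ball and to 1/|s| inside
  it. Minimality of the exponent gives the lower bound, and \<open>1 \<le> r\<close> covers exponent
  0.\<close>

lemma dyadic_bracket:
  fixes r :: real
  assumes "1 \<le> r"
  obtains n where "2 ^ n \<le> r" "r \<le> 2 ^ Suc n"
proof -
  obtain k where "r < 2 ^ k" using real_arch_pow[of 2 r] by auto
  then have ex: "r \<le> 2 ^ Suc k" using assms by simp
  define n where "n = (LEAST n. r \<le> 2 ^ Suc n)"
  have "r \<le> 2 ^ Suc n" unfolding n_def using ex by (rule LeastI)
  moreover have "2 ^ n \<le> r"
  proof (cases n)
    case (Suc m)
    then have "m < (LEAST n. r \<le> 2 ^ Suc n)" by (simp add: n_def)
    from not_less_Least[OF this] show ?thesis using Suc by simp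
  qed (use assms in simp)
  ultimately show ?thesis using that by blast
qed

text \<open>With q the dimension, the function is |s|^(1-q) inside the unit ball and |s|^(-1-q)
  outside. On each dyadic shell it is bounded by a constant times the indicator of a ball, and the
  integrals of these majorants form a geometric series.\<close>

lemma integrable_powr_norm_min:
  "integrable lborel (\<lambda>s::'y::euclidean_space. norm s powr (- 1 - real DIM('y)) * min 1 ((norm s)\<^sup>2))"
    (is "integrable _ ?w")
proof (rule integrableI_bounded)
  define d where "d = DIM('y)"
  define V where "V = unit_ball_vol (real d)"
  have "V \<ge> 0" by (simp add: V_def)
  \<comment> \<open>\<open>a n\<close> bounds the function on 2^-(n+1) <= |s| <= 2^-n, using the
    lower radius for the negative power and the upper one for |s|^2; \<open>b n\<close> bounds it on
    2^n <= |s| <= 2^(n+1).\<close>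
  define a :: "nat \<Rightarrow> real" where "a n = (2 ^ Suc n) ^ Suc d * (1 / 2 ^ n)\<^sup>2" for n
  define b :: "nat \<Rightarrow> real" where "b n = (1 / 2 ^ n) ^ Suc d" for n
  have ab: "a n \<ge> 0" "b n \<ge> 0" for n by (auto simp: a_def b_def)
  \<comment> \<open>Whole balls replace the shells: their volumes are explicit, and the overlap only
    enlarges the majorant.\<close>
  define F :: "nat \<Rightarrow> 'y \<Rightarrow> ennreal" where
    "F n s = ennreal (a n) * indicator (cball 0 (1 / 2 ^ n)) s +
       ennreal (b n) * indicator (cball 0 (2 ^ Suc n)) s" for n s
  have powr_eq: "norm s powr (- 1 - real d) = (1 / norm s) ^ Suc d" if "s \<noteq> 0" for s :: 'y
  proof -
    have "norm s powr (- 1 - real d) = norm s powr (- real (Suc d))" by simp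
    also have "\<dots> = inverse (norm s powr real (Suc d))" by (rule powr_minus)
    also have "norm s powr real (Suc d) = norm s ^ Suc d"
      using that by (intro powr_realpow) simp
    finally show ?thesis by (simp add: power_inverse divide_inverse)
  qed
  have [measurable]: "cball (0::'y) r \<in> sets borel" for r by (rule borel_closed) simp
  have bound: "ennreal (?w s) \<le> (\<Sum>n. F n s)" for s
  proof -
    have term_le: "F n s \<le> (\<Sum>n. F n s)" for n
      using sum_le_suminf[of "\<lambda>n. F n s" "{n}"] by simp
    \<comment> \<open>At the origin the left-hand side is 0, since
      \<open>0 powr x = 0\<close>.\<close>
    show ?thesis
    proof (cases "s = 0")
      case False
      then have pos: "norm s > 0" by simp
      note w_eq = powr_eq[OF False, folded d_def]
      show ?thesis
      proof (cases "norm s \<le> 1")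
        case True
        with pos have "1 \<le> 1 / norm s" by simp
        then obtain n where n: "2 ^ n \<le> 1 / norm s" "1 / norm s \<le> 2 ^ Suc n"
          by (rule dyadic_bracket)
        then have small: "norm s \<le> 1 / 2 ^ n" using pos by (simp add: field_simps)
        have "?w s \<le> (1 / norm s) ^ Suc d * (norm s)\<^sup>2"
          unfolding d_def[symmetric] w_eq by (intro mult_left_mono) auto
        also have "\<dots> \<le> a n"
          unfolding a_def using n small pos by (intro mult_mono power_mono) auto
        finally have "ennreal (?w s) \<le> ennreal (a n) * indicator (cball 0 (1 / 2 ^ n)) s"
          using small by (simp add: ennreal_leI)
        also have "\<dots> \<le> F n s" unfolding F_def by simp
        finally show ?thesis using term_le[of n] by (rule order_trans)
      next
        case False
        then obtain n where n: "2 ^ n \<le> norm s" "norm s \<le> 2 ^ Suc n"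
          using dyadic_bracket[of "norm s"] by auto
        then have inv: "1 / norm s \<le> 1 / 2 ^ n" using pos by (simp add: field_simps)
        have "?w s \<le> (1 / norm s) ^ Suc d * 1"
          unfolding d_def[symmetric] w_eq by (intro mult_left_mono) auto
        also have "\<dots> \<le> b n"
          unfolding b_def mult_1_right using inv pos by (intro power_mono) auto
        finally have "ennreal (?w s) \<le> ennreal (b n) * indicator (cball 0 (2 ^ Suc n)) s"
          using n by (simp add: ennreal_leI)
        also have "\<dots> \<le> F n s" unfolding F_def by simp
        finally show ?thesis using term_le[of n] by (rule order_trans)
      qed
    qed simp
  qed
  have "(\<integral>\<^sup>+s. ennreal (norm (?w s)) \<partial>lborel) \<le> (\<integral>\<^sup>+s. (\<Sum>n. F n s) \<partial>lborel)"
    using bound by (intro nn_integral_mono) simp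
  also have "\<dots> = (\<Sum>n. \<integral>\<^sup>+s. F n s \<partial>lborel)"
    unfolding F_def by (intro nn_integral_suminf) measurable
  also have "\<dots> = (\<Sum>n. ennreal (3 * V * 2 ^ d * (1 / 2) ^ n))"
  proof (intro suminf_cong)
    fix n
    have "(\<integral>\<^sup>+s. F n s \<partial>lborel) = ennreal (a n) * ennreal (V * (1 / 2 ^ n) ^ d) + ennreal (b n) * ennreal (V * (2 ^ Suc n) ^ d)"
      unfolding F_def
      by (simp add: nn_integral_add nn_integral_cmult emeasure_cball V_def d_def)
    also have "\<dots> = ennreal (a n * (V * (1 / 2 ^ n) ^ d) + b n * (V * (2 ^ Suc n) ^ d))"
      using ab \<open>V \<ge> 0\<close> by (simp add: ennreal_mult ennreal_plus)
    \<comment> \<open>The inner term is 2 * V * 2^d * 2^-n and the outer one V * 2^d * 2^-n, whence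
      the factor 3.\<close>
    also have "a n * (V * (1 / 2 ^ n) ^ d) + b n * (V * (2 ^ Suc n) ^ d) = 3 * V * 2 ^ d * (1 / 2) ^ n"
      unfolding a_def b_def
      by (simp add: power_divide power_mult_distrib power2_eq_square divide_simps)
    finally show "(\<integral>\<^sup>+s. F n s \<partial>lborel) = ennreal (3 * V * 2 ^ d * (1 / 2) ^ n)" .
  qed
  also have "\<dots> < \<infinity>"
  proof -
    have "summable (\<lambda>n. 3 * V * 2 ^ d * (1 / 2 :: real) ^ n)" by (intro summable_mult summable_geometric) simp
    then show ?thesis using \<open>V \<ge> 0\<close> by (subst suminf_ennreal2) auto
  qed
  finally show "(\<integral>\<^sup>+s. ennreal (norm (?w s)) \<partial>lborel) < \<infinity>" .
qed measurable

subsection \<open>The martingale difference divergence operator\<close>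

lemma norm_integral_le_integral:
  fixes f :: "'a \<Rightarrow> 'b::{banach,second_countable_topology}"
  assumes "integrable M f" "integrable M g" "\<And>x. norm (f x) \<le> g x"
  shows "norm (integral\<^sup>L M f) \<le> integral\<^sup>L M g"
  using assms by (intro order_trans[OF integral_norm_bound] integral_mono integrable_norm)

text \<open>Real and imaginary part have two summands each, and each of the four is at most K^2 |z|
  by Cauchy-Schwarz.\<close>

lemma norm_tensor_conj_le:
  assumes "norm (fst x) \<le> K" "norm (snd x) \<le> K"
  shows "norm (tensor_HC x (conj_HC x) z) \<le> 4 * K\<^sup>2 * norm z"
proof -
  have "norm ((u \<bullet> z) *\<^sub>R v) \<le> K\<^sup>2 * norm z" if "norm u \<le> K" "norm v \<le> K" for u v
  proof -
    have "K \<ge> 0" using that(1) norm_ge_zero order_trans by blast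
    have "norm ((u \<bullet> z) *\<^sub>R v) \<le> (norm u * norm z) * norm v"
      by (simp add: Cauchy_Schwarz_ineq2 mult_right_mono)
    also have "\<dots> \<le> (K * norm z) * K"
      using that \<open>K \<ge> 0\<close> by (intro mult_mono) auto
    finally show ?thesis by (simp add: power2_eq_square ac_simps)
  qed
  note bound = this
  let ?a = "fst x" and ?b = "snd x"
  have "norm (tensor_HC x (conj_HC x) z) \<le>
      norm ((?a \<bullet> z) *\<^sub>R ?a + (?b \<bullet> z) *\<^sub>R ?b) + norm (- ((?a \<bullet> z) *\<^sub>R ?b) + (?b \<bullet> z) *\<^sub>R ?a)"
    unfolding tensor_HC_def conj_HC_def Let_def by (rule order_trans[OF norm_Pair_le]) simp
  also have "\<dots> \<le> (K\<^sup>2 * norm z + K\<^sup>2 * norm z) + (K\<^sup>2 * norm z + K\<^sup>2 * norm z)"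
    by (intro add_mono norm_triangle_le) (simp_all only: norm_minus_cancel bound assms)
  finally show ?thesis by (simp add: ac_simps)
qed

text \<open>This is the squared modulus of the pairing of \<open>x\<close> with \<open>z\<close>.
  Being a sum of squares, it makes the quadratic form of the MDDO nonnegative.\<close>

lemma inner_fst_tensor_conj:
  "fst (tensor_HC x (conj_HC x) z) \<bullet> z = (fst x \<bullet> z)\<^sup>2 + (snd x \<bullet> z)\<^sup>2"
  by (simp add: tensor_HC_def conj_HC_def Let_def inner_simps power2_eq_square)

text \<open>Dominated convergence along sequences: every nonzero \<open>s\<close> eventually lies in
  the truncation shells. The origin never does, and \<open>F 0 = 0\<close> gives convergence there
  as well.\<close>

lemma tendsto_principal_value:
  fixes F :: "'y::euclidean_space \<Rightarrow> 'b::{banach,second_countable_topology}"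
  assumes int: "integrable lborel F" and "F 0 = 0"
  shows "((\<lambda>\<epsilon>. LINT s:{s. \<epsilon> \<le> norm s \<and> norm s \<le> inverse \<epsilon>}|lborel. F s) \<longlongrightarrow> integral\<^sup>L lborel F) (at_right 0)"
  unfolding tendsto_at_iff_sequentially comp_def
proof (intro allI impI)
  fix \<epsilon> :: "nat \<Rightarrow> real"
  assume "\<forall>i. \<epsilon> i \<in> {0<..} - {0}" and lim: "\<epsilon> \<longlonglongrightarrow> 0"
  then have pos: "\<epsilon> i > 0" for i by auto
  have [measurable]: "F \<in> borel_measurable borel" using int by auto
  define S where "S i = {s::'y. \<epsilon> i \<le> norm s \<and> norm s \<le> inverse (\<epsilon> i)}" for i
  have [measurable]: "S i \<in> sets borel" for i unfolding S_def by measurable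
  show "(\<lambda>i. LINT s:{s. \<epsilon> i \<le> norm s \<and> norm s \<le> inverse (\<epsilon> i)}|lborel. F s) \<longlonglongrightarrow> integral\<^sup>L lborel F"
    unfolding set_lebesgue_integral_def S_def[symmetric]
  proof (rule integral_dominated_convergence)
    show "integrable lborel (\<lambda>s. norm (F s))" using int by simp
    have "(\<lambda>i. indicator (S i) s *\<^sub>R F s) \<longlonglongrightarrow> F s" for s
    proof (cases "s = 0")
      case True then show ?thesis using \<open>F 0 = 0\<close> by simp
    next
      case False
      then have "eventually (\<lambda>i. \<epsilon> i < norm s) sequentially" "eventually (\<lambda>i. \<epsilon> i < inverse (norm s)) sequentially"
        using lim by (auto intro!: order_tendstoD)
      then have "eventually (\<lambda>i. indicator (S i) s *\<^sub>R F s = F s) sequentially"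
      proof eventually_elim
        case (elim i)
        have "norm s \<le> inverse (\<epsilon> i)"
          using elim pos[of i] False by (simp add: field_simps)
        then have "s \<in> S i" using elim by (simp add: S_def)
        then show ?case by simp
      qed
      then show ?thesis by (rule tendsto_eventually)
    qed
    then show "AE s in lborel. (\<lambda>i. indicator (S i) s *\<^sub>R F s) \<longlonglongrightarrow> F s" by simp
  qed (auto simp: indicator_def)
qed

lemma c_const_pos: "c_const q > 0"
  unfolding c_const_def by (intro divide_pos_pos Gamma_real_pos) auto

text \<open>These moment conditions are what bounds \<open>G_s\<close> by a multiple of min 1 |s|.
  They pass from \<open>X\<close> to its image under a bounded linear map, so the locale can be
  interpreted again for that image.\<close>

locale mean_zero_pair = prob_space M
  for M :: "'a measure" and X :: "'a \<Rightarrow> 'h::{real_inner,banach,second_countable_topology}"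
    and Y :: "'a \<Rightarrow> 'y::euclidean_space" +
  assumes integrable_X: "integrable M X"
    and measurable_Y [measurable]: "Y \<in> borel_measurable M"
    and integrable_XY: "integrable M (\<lambda>\<omega>. norm (X \<omega>) * norm (Y \<omega>))"
    and mean_zero: "integral\<^sup>L M X = 0"
begin

section \<open>Continuity and size of \<open>G_s\<close>\<close>

lemma measurable_X [measurable]: "X \<in> borel_measurable M"
  using integrable_X by auto

text \<open>Here \<open>f\<close> stands for either component, \<open>cos\<close> or
  \<open>\<lambda>t. - sin t\<close>, of the conjugate exponential, so that one argument serves
  both.\<close>

lemma integrable_scaleR_X:
  assumes "f \<in> borel_measurable borel" "\<And>t. \<bar>f t\<bar> \<le> 1"
  shows "integrable M (\<lambda>\<omega>. f (s \<bullet> Y \<omega>) *\<^sub>R X \<omega>)"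
  using assms(1) by (intro Bochner_Integration.integrable_bound[OF integrable_X])
    (auto intro!: mult_left_le_one_le assms(2))

text \<open>The mean of the exponential is a constant multiplying \<open>X\<close>, so it disappears
  with E X = 0. The minus sign comes from the conjugation in \<open>cov_HC\<close>.\<close>

lemma G_fun_eq:
  "G_fun M X Y s = (LINT \<omega>|M. cos (s \<bullet> Y \<omega>) *\<^sub>R X \<omega>, LINT \<omega>|M. (- sin (s \<bullet> Y \<omega>)) *\<^sub>R X \<omega>)"
proof -
  have "(LINT \<omega>|M. (f (s \<bullet> Y \<omega>) - c) *\<^sub>R X \<omega>) = (LINT \<omega>|M. f (s \<bullet> Y \<omega>) *\<^sub>R X \<omega>)"
    if "f \<in> borel_measurable borel" "\<And>t. \<bar>f t\<bar> \<le> 1" for f c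
    using integrable_scaleR_X[OF that] integrable_X
    by (simp add: scaleR_diff_left mean_zero)
  from this[of cos "Re _"] this[of "\<lambda>t. - sin t" "- Im _"] show ?thesis
    unfolding G_fun_def cov_HC_def Let_def mean_zero by (simp add: algebra_simps)
qed

lemma continuous_integral_scaleR_X:
  fixes f :: "real \<Rightarrow> real"
  assumes f: "continuous_on UNIV f" "\<And>t. \<bar>f t\<bar> \<le> 1"
  shows "continuous_on UNIV (\<lambda>s. LINT \<omega>|M. f (s \<bullet> Y \<omega>) *\<^sub>R X \<omega>)"
  unfolding continuous_on_sequentially comp_def
proof (intro ballI allI impI, elim conjE)
  fix u :: "nat \<Rightarrow> 'y" and s assume u: "u \<longlonglongrightarrow> s"
  have [measurable]: "f \<in> borel_measurable borel" using f(1) by (rule borel_measurable_continuous_onI)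
  show "(\<lambda>n. LINT \<omega>|M. f (u n \<bullet> Y \<omega>) *\<^sub>R X \<omega>) \<longlonglongrightarrow> (LINT \<omega>|M. f (s \<bullet> Y \<omega>) *\<^sub>R X \<omega>)"
  proof (rule integral_dominated_convergence)
    show "integrable M (\<lambda>\<omega>. norm (X \<omega>))" using integrable_X by simp
    have "(\<lambda>n. f (u n \<bullet> Y \<omega>)) \<longlonglongrightarrow> f (s \<bullet> Y \<omega>)" for \<omega>
      using f(1) u by (intro continuous_on_tendsto_compose[OF f(1)] tendsto_inner) auto
    then show "AE \<omega> in M. (\<lambda>n. f (u n \<bullet> Y \<omega>) *\<^sub>R X \<omega>) \<longlonglongrightarrow> f (s \<bullet> Y \<omega>) *\<^sub>R X \<omega>"
      by (intro AE_I2 tendsto_scaleR tendsto_const)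
  qed (auto intro!: mult_left_le_one_le f(2))
qed

text \<open>Serves twice: for measurability of the MDDO integrand, and to pass from almost every
  \<open>s\<close> to every \<open>s\<close>.\<close>

lemma continuous_G_fun: "continuous_on UNIV (G_fun M X Y)"
  unfolding G_fun_eq[abs_def]
  by (intro continuous_on_Pair continuous_integral_scaleR_X[where f = cos]
        continuous_integral_scaleR_X[where f = "\<lambda>t. - sin t"] continuous_intros) auto

text \<open>The bound \<open>C\<close> comes from bounded trigonometric factors. For the bound C
  |s|, E X = 0 allows the constant f 0 to be subtracted, and |f t - f 0| <= |t| with Cauchy-Schwarz
  produces |s| |Y|.\<close>

lemma norm_G_fun_le:
  defines "C \<equiv> (LINT \<omega>|M. norm (X \<omega>)) + (LINT \<omega>|M. norm (X \<omega>) * norm (Y \<omega>))"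
  shows "norm (fst (G_fun M X Y s)) \<le> C * min 1 (norm s)"
    and "norm (snd (G_fun M X Y s)) \<le> C * min 1 (norm s)"
proof -
  have *: "norm (LINT \<omega>|M. f (s \<bullet> Y \<omega>) *\<^sub>R X \<omega>) \<le> C * min 1 (norm s)"
    if f[measurable]: "f \<in> borel_measurable borel" "\<And>t. \<bar>f t\<bar> \<le> 1" and lip: "\<And>t. \<bar>f t - c\<bar> \<le> \<bar>t\<bar>" for f c
  proof -
    have nonneg: "0 \<le> (LINT \<omega>|M. norm (X \<omega>))" "0 \<le> (LINT \<omega>|M. norm (X \<omega>) * norm (Y \<omega>))" by auto
    have "norm (LINT \<omega>|M. f (s \<bullet> Y \<omega>) *\<^sub>R X \<omega>) \<le> (LINT \<omega>|M. norm (X \<omega>))"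
      by (intro norm_integral_le_integral integrable_scaleR_X integrable_norm integrable_X f)
        (auto intro!: mult_left_le_one_le f(2))
    then have 1: "norm (LINT \<omega>|M. f (s \<bullet> Y \<omega>) *\<^sub>R X \<omega>) \<le> C"
      using nonneg unfolding C_def by linarith
    have int: "integrable M (\<lambda>\<omega>. (f (s \<bullet> Y \<omega>) - c) *\<^sub>R X \<omega>)"
      using integrable_scaleR_X[OF f, of s] integrable_X by (simp add: scaleR_diff_left)
    have "(LINT \<omega>|M. f (s \<bullet> Y \<omega>) *\<^sub>R X \<omega>) = (LINT \<omega>|M. (f (s \<bullet> Y \<omega>) - c) *\<^sub>R X \<omega>)"
      using integrable_scaleR_X[OF f, of s] integrable_X by (simp add: scaleR_diff_left mean_zero)
    also have "norm \<dots> \<le> (LINT \<omega>|M. norm s * (norm (X \<omega>) * norm (Y \<omega>)))"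
    proof (intro norm_integral_le_integral int)
      show "integrable M (\<lambda>\<omega>. norm s * (norm (X \<omega>) * norm (Y \<omega>)))" using integrable_XY by simp
      show "norm ((f (s \<bullet> Y \<omega>) - c) *\<^sub>R X \<omega>) \<le> norm s * (norm (X \<omega>) * norm (Y \<omega>))" for \<omega>
      proof -
        have "\<bar>f (s \<bullet> Y \<omega>) - c\<bar> * norm (X \<omega>) \<le> (norm s * norm (Y \<omega>)) * norm (X \<omega>)"
          by (intro mult_right_mono order_trans[OF lip] Cauchy_Schwarz_ineq2) simp
        then show ?thesis by (simp add: ac_simps)
      qed
    qed
    also have "\<dots> \<le> C * norm s"
      using nonneg by (simp add: C_def algebra_simps)
    finally show ?thesis using 1 by (simp add: min_def)
  qed
  have cos_lip: "\<bar>cos t - 1\<bar> \<le> \<bar>t\<bar>" for t :: real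
  proof -
    \<comment> \<open>In the half-angle form one sine factor is bounded by |t/2| and the other by
      1.\<close>
    have "cos t - 1 = - 2 * (sin (t / 2))\<^sup>2" using cos_double_sin[of "t/2"] by simp
    then have "\<bar>cos t - 1\<bar> = 2 * \<bar>sin (t / 2)\<bar> * \<bar>sin (t / 2)\<bar>" by (simp add: power2_eq_square abs_mult)
    also have "\<dots> \<le> 2 * \<bar>t / 2\<bar> * 1" by (intro mult_mono abs_sin_x_le_abs_x) auto
    finally show ?thesis by simp
  qed
  show "norm (fst (G_fun M X Y s)) \<le> C * min 1 (norm s)"
    unfolding G_fun_eq fst_conv by (rule *[of cos 1, OF _ _ cos_lip]) auto
  show "norm (snd (G_fun M X Y s)) \<le> C * min 1 (norm s)"
    unfolding G_fun_eq snd_conv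
    by (rule *[of "\<lambda>t. - sin t" 0]) (auto simp: abs_sin_x_le_abs_x)
qed

section \<open>The MDDO as an absolutely convergent integral\<close>

definition mddo_integrand :: "'h \<Rightarrow> 'y \<Rightarrow> 'h \<times> 'h" where
  "mddo_integrand z s = (norm s powr (- 1 - real DIM('y))) *\<^sub>R
     tensor_HC (G_fun M X Y s) (conj_HC (G_fun M X Y s)) z"

lemma integrable_mddo_integrand: "integrable lborel (mddo_integrand z)"
proof -
  define C where "C = (LINT \<omega>|M. norm (X \<omega>)) + (LINT \<omega>|M. norm (X \<omega>) * norm (Y \<omega>))"
  let ?w = "\<lambda>s::'y. norm s powr (- 1 - real DIM('y))"
  have "continuous_on UNIV (\<lambda>s. tensor_HC (G_fun M X Y s) (conj_HC (G_fun M X Y s)) z)"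
    unfolding tensor_HC_def conj_HC_def Let_def fst_conv snd_conv
    by (intro continuous_intros continuous_G_fun)
  then have [measurable]: "(\<lambda>s. tensor_HC (G_fun M X Y s) (conj_HC (G_fun M X Y s)) z) \<in> borel_measurable borel"
    by (rule borel_measurable_continuous_onI)
  show ?thesis
  proof (rule Bochner_Integration.integrable_bound)
    \<comment> \<open>The tensor is quadratic in \<open>G_s\<close>, so its bound is
      \<open>norm_tensor_conj_le\<close> with K = C min 1 |s|; squaring the minimum gives the
      integrable weight.\<close>
    show "integrable lborel (\<lambda>s::'y. 4 * C\<^sup>2 * norm z * (?w s * min 1 ((norm s)\<^sup>2)))"
      by (intro integrable_mult_right integrable_powr_norm_min)
    show "mddo_integrand z \<in> borel_measurable lborel"
      unfolding mddo_integrand_def[abs_def] by measurable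
    have "norm (mddo_integrand z s) \<le> norm (4 * C\<^sup>2 * norm z * (?w s * min 1 ((norm s)\<^sup>2)))" for s
    proof -
      have "(min 1 (norm s))\<^sup>2 = min 1 ((norm s)\<^sup>2)"
        using power_le_one[of "norm s" 2] one_le_power[of "norm s" 2]
        by (cases "norm s \<le> 1") (auto simp: min_def)
      then have "norm (tensor_HC (G_fun M X Y s) (conj_HC (G_fun M X Y s)) z) \<le> 4 * (C\<^sup>2 * min 1 ((norm s)\<^sup>2)) * norm z"
        using norm_tensor_conj_le[OF norm_G_fun_le[of s]] by (simp add: power_mult_distrib C_def)
      then have "norm (mddo_integrand z s) \<le> ?w s * (4 * (C\<^sup>2 * min 1 ((norm s)\<^sup>2)) * norm z)"
        unfolding mddo_integrand_def by (simp add: mult_left_mono)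
      also have "\<dots> = norm (4 * C\<^sup>2 * norm z * (?w s * min 1 ((norm s)\<^sup>2)))"
        by (simp add: abs_mult)
      finally show ?thesis .
    qed
    then show "AE s in lborel. norm (mddo_integrand z s) \<le> norm (4 * C\<^sup>2 * norm z * (?w s * min 1 ((norm s)\<^sup>2)))"
      by simp
  qed
qed

text \<open>\<open>Lim\<close> is determined once convergence is established. The integrand vanishes
  at the origin because \<open>0 powr x = 0\<close>, so the principal value lemma applies.\<close>

lemma MDDO_eq_integral:
  "MDDO M X Y z = inverse (c_const DIM('y)) *\<^sub>R integral\<^sup>L lborel (mddo_integrand z)"
proof -
  have "mddo_integrand z 0 = 0" by (simp add: mddo_integrand_def)
  from tendsto_principal_value[OF integrable_mddo_integrand this]
  show ?thesis
    unfolding MDDO_def mddo_integrand_def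
    by (subst tendsto_Lim[OF trivial_limit_at_right_real]) auto
qed

section \<open>Vanishing of the MDDO and conditional mean zero\<close>

lemma MDDO_zero_imp_integral_zero:
  assumes zero: "\<And>z. MDDO M X Y z = 0" and A[measurable]: "A \<in> sets borel"
  shows "(LINT \<omega>|M. indicator A (Y \<omega>) *\<^sub>R X \<omega>) = 0"
proof -
  let ?G = "G_fun M X Y"
  have int_A: "integrable M (\<lambda>\<omega>. indicator A (Y \<omega>) *\<^sub>R X \<omega>)"
    by (rule Bochner_Integration.integrable_bound[OF integrable_X]) (auto simp: indicator_def)
  have "(LINT \<omega>|M. indicator A (Y \<omega>) *\<^sub>R X \<omega>) \<bullet> z = 0" for z
  proof -
    let ?w = "\<lambda>s::'y. norm s powr (- 1 - real DIM('y))"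
    let ?q = "\<lambda>s. (fst (?G s) \<bullet> z)\<^sup>2 + (snd (?G s) \<bullet> z)\<^sup>2"
    have lin: "bounded_linear (\<lambda>p::'h \<times> 'h. fst p \<bullet> z)"
      by (intro bounded_linear_inner_left_comp bounded_linear_fst)
    have eq: "fst (mddo_integrand z s) \<bullet> z = ?w s * ?q s" for s
      by (simp add: mddo_integrand_def inner_fst_tensor_conj)
    have "integral\<^sup>L lborel (mddo_integrand z) = 0"
      using zero[of z] c_const_pos[of "DIM('y)"] by (simp add: MDDO_eq_integral)
    then have "(LINT s|lborel. ?w s * ?q s) = 0"
      using integral_bounded_linear[OF lin integrable_mddo_integrand, of z] by (simp add: eq)
    moreover have "integrable lborel (\<lambda>s. ?w s * ?q s)"
      using integrable_bounded_linear[OF lin integrable_mddo_integrand, of z] by (simp add: eq)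
    ultimately have "AE s in lborel. ?w s * ?q s = 0"
      by (subst (asm) integral_nonneg_eq_0_iff_AE) auto
    \<comment> \<open>The weight is positive off the origin, and the origin is a null set.\<close>
    then have "AE s in lborel. s \<in> {s. ?q s = 0}"
      using AE_lborel_singleton[of 0] by eventually_elim auto
    \<comment> \<open>A closed set of full Lebesgue measure is the whole space; the fact used for
      this concerns the completed measure.\<close>
    then have "AE s in lebesgue. s \<in> {s. ?q s = 0}" by (rule AE_completion)
    moreover have "closed {s. ?q s = 0}"
      by (intro closed_Collect_eq continuous_intros continuous_G_fun)
    ultimately have "?q s = 0" for s using mem_closed_if_AE_lebesgue by blast
    then have G_zero: "fst (?G s) \<bullet> z = 0" "snd (?G s) \<bullet> z = 0" for s
      by (simp_all add: sum_power2_eq_zero_iff)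
    have inner_int: "(LINT \<omega>|M. f (s \<bullet> Y \<omega>) * (X \<omega> \<bullet> z)) = (LINT \<omega>|M. f (s \<bullet> Y \<omega>) *\<^sub>R X \<omega>) \<bullet> z"
      if "f \<in> borel_measurable borel" "\<And>t. \<bar>f t\<bar> \<le> 1" for f s
      using integral_inner_left[of z M "\<lambda>\<omega>. f (s \<bullet> Y \<omega>) *\<^sub>R X \<omega>"] integrable_scaleR_X[OF that] by simp
    have int_Xz: "integrable M (\<lambda>\<omega>. X \<omega> \<bullet> z)" using integrable_X by simp
    have "(LINT \<omega>|M. (X \<omega> \<bullet> z) *\<^sub>R cis (s \<bullet> Y \<omega>)) = 0" for s
    proof -
      have "integrable M (\<lambda>\<omega>. (X \<omega> \<bullet> z) *\<^sub>R cis (s \<bullet> Y \<omega>))"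
        by (rule Bochner_Integration.integrable_bound[OF int_Xz]) auto
      moreover have "(LINT \<omega>|M. cos (s \<bullet> Y \<omega>) * (X \<omega> \<bullet> z)) = 0"
        using inner_int[of cos s] G_zero(1)[of s] by (simp add: G_fun_eq)
      moreover have "(LINT \<omega>|M. - sin (s \<bullet> Y \<omega>) * (X \<omega> \<bullet> z)) = 0"
        using inner_int[of "\<lambda>t. - sin t" s] G_zero(2)[of s] by (simp add: G_fun_eq)
      ultimately show ?thesis
        by (simp add: complex_eq_iff mult.commute flip: integral_Re integral_Im)
    qed
    from fourier_zero_imp_integral_zero[OF int_Xz measurable_Y this A]
    have "(LINT \<omega>|M. (indicator A (Y \<omega>) *\<^sub>R X \<omega>) \<bullet> z) = 0" by (simp add: mult.commute)
    then show ?thesis using integral_inner_left[of z M "\<lambda>\<omega>. indicator A (Y \<omega>) *\<^sub>R X \<omega>"] int_A by simp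
  qed
  then show ?thesis by (metis inner_eq_zero_iff)
qed

lemma sets_sigma_Y: "sets (sigma_rv M Y) = {Y -` A \<inter> space M | A. A \<in> sets borel}"
  by (rule sets_vimage_algebra2) auto

lemma subalgebra_sigma_Y: "subalgebra M (sigma_rv M Y)"
  unfolding subalgebra_def sets_sigma_Y by auto

text \<open>A version that is zero almost everywhere has zero integral over every set; conversely,
  the zero function is then itself a version.\<close>

lemma cond_exp_zero_ae_iff:
  "cond_exp_zero_ae M X Y \<longleftrightarrow> (\<forall>A\<in>sets (sigma_rv M Y). (LINT \<omega>:A|M. X \<omega>) = 0)"
proof
  assume "cond_exp_zero_ae M X Y"
  then obtain Z where Z: "has_cond_exp M (sigma_rv M Y) X Z" "AE \<omega> in M. Z \<omega> = 0"
    unfolding cond_exp_zero_ae_def by blast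
  have "(LINT \<omega>:A|M. Z \<omega>) = 0" for A
    unfolding set_lebesgue_integral_def using Z(2) by (intro integral_eq_zero_AE) auto
  then show "\<forall>A\<in>sets (sigma_rv M Y). (LINT \<omega>:A|M. X \<omega>) = 0"
    using Z(1) unfolding has_cond_exp_def by simp
next
  assume "\<forall>A\<in>sets (sigma_rv M Y). (LINT \<omega>:A|M. X \<omega>) = 0"
  then have "has_cond_exp M (sigma_rv M Y) X (\<lambda>_. 0)"
    unfolding has_cond_exp_def by (simp add: set_lebesgue_integral_def)
  then show "cond_exp_zero_ae M X Y" unfolding cond_exp_zero_ae_def by auto
qed

text \<open>Pairing with \<open>z\<close> reduces to real conditional expectations: that of
  \<open>X \<omega> \<bullet> z\<close> given \<open>Y\<close> vanishes, and \<open>cos\<close> or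
  \<open>- sin\<close> of \<open>s \<bullet> Y \<omega>\<close>, being measurable with respect to
  \<open>Y\<close>, can be moved inside it.\<close>

lemma integral_zero_imp_G_fun_zero:
  assumes zero: "\<And>A. A \<in> sets (sigma_rv M Y) \<Longrightarrow> (LINT \<omega>:A|M. X \<omega>) = 0"
  shows "G_fun M X Y s = 0"
proof -
  interpret finite_measure_subalgebra M "sigma_rv M Y"
    by standard (rule subalgebra_sigma_Y)
  have inner_zero: "(LINT \<omega>|M. f (s \<bullet> Y \<omega>) *\<^sub>R X \<omega>) \<bullet> z = 0"
    if f: "f \<in> borel_measurable borel" "\<And>t. \<bar>f t\<bar> \<le> 1" for f z
  proof -
    have int_Xz: "integrable M (\<lambda>\<omega>. X \<omega> \<bullet> z)" using integrable_X by simp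
    have Xz_meas: "(\<lambda>\<omega>. X \<omega> \<bullet> z) \<in> borel_measurable M" by measurable
    have "AE \<omega> in M. real_cond_exp M (sigma_rv M Y) (\<lambda>\<omega>. X \<omega> \<bullet> z) \<omega> = 0"
    proof (rule real_cond_exp_charact)
      fix A assume A: "A \<in> sets (sigma_rv M Y)"
      then have "A \<in> sets M" using subalgebra_sigma_Y by (auto simp: subalgebra_def)
      then have "integrable M (\<lambda>\<omega>. indicator A \<omega> *\<^sub>R X \<omega>)"
        using integrable_X by (rule integrable_mult_indicator)
      from integral_inner_left[OF this, of z]
      show "(LINT \<omega>:A|M. X \<omega> \<bullet> z) = (LINT \<omega>:A|M. 0)"
        using zero[OF A] by (simp add: set_lebesgue_integral_def)
    qed (use int_Xz in auto)
    then have "(LINT \<omega>|M. f (s \<bullet> Y \<omega>) * real_cond_exp M (sigma_rv M Y) (\<lambda>\<omega>. X \<omega> \<bullet> z) \<omega>) = 0"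
      by (intro integral_eq_zero_AE) auto
    moreover have "(\<lambda>\<omega>. f (s \<bullet> Y \<omega>)) \<in> borel_measurable (sigma_rv M Y)"
    proof -
      have "Y \<in> borel_measurable (sigma_rv M Y)" by (rule measurable_vimage_algebra1) auto
      then show ?thesis using f(1) by measurable
    qed
    moreover have "integrable M (\<lambda>\<omega>. f (s \<bullet> Y \<omega>) * (X \<omega> \<bullet> z))"
      using integrable_inner_left[OF integrable_scaleR_X[OF f, of s], of z] by simp
    ultimately have "(LINT \<omega>|M. f (s \<bullet> Y \<omega>) * (X \<omega> \<bullet> z)) = 0"
      using real_cond_exp_intg(2)[of "\<lambda>\<omega>. f (s \<bullet> Y \<omega>)" "\<lambda>\<omega>. X \<omega> \<bullet> z"] Xz_meas by simp
    then show ?thesis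
      using integral_inner_left[of z M "\<lambda>\<omega>. f (s \<bullet> Y \<omega>) *\<^sub>R X \<omega>"] integrable_scaleR_X[OF f] by simp
  qed
  have *: "(LINT \<omega>|M. f (s \<bullet> Y \<omega>) *\<^sub>R X \<omega>) = 0"
    if "f \<in> borel_measurable borel" "\<And>t. \<bar>f t\<bar> \<le> 1" for f
    \<comment> \<open>A vector orthogonal to every \<open>z\<close> is orthogonal to itself.\<close>
    using inner_zero[OF that, of "LINT \<omega>|M. f (s \<bullet> Y \<omega>) *\<^sub>R X \<omega>"] by simp
  show ?thesis
    using *[of cos] *[of "\<lambda>t. - sin t"] unfolding G_fun_eq by (simp add: zero_prod_def)
qed

lemma MDDO_zero_iff: "(\<forall>z. MDDO M X Y z = 0) \<longleftrightarrow> cond_exp_zero_ae M X Y"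
proof
  assume zero: "\<forall>z. MDDO M X Y z = 0"
  have "(LINT \<omega>:Y -` A \<inter> space M|M. X \<omega>) = 0" if "A \<in> sets borel" for A
  proof -
    have "(LINT \<omega>:Y -` A \<inter> space M|M. X \<omega>) = (LINT \<omega>|M. indicator A (Y \<omega>) *\<^sub>R X \<omega>)"
      unfolding set_lebesgue_integral_def by (intro Bochner_Integration.integral_cong) (auto simp: indicator_def)
    then show ?thesis using MDDO_zero_imp_integral_zero[OF _ that] zero by simp
  qed
  then show "cond_exp_zero_ae M X Y" unfolding cond_exp_zero_ae_iff sets_sigma_Y by auto
next
  assume "cond_exp_zero_ae M X Y"
  then have "G_fun M X Y s = 0" for s
    using integral_zero_imp_G_fun_zero unfolding cond_exp_zero_ae_iff by blast
  then have "mddo_integrand z = (\<lambda>_. 0)" for z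
    by (simp add: mddo_integrand_def tensor_HC_def zero_prod_def Let_def fun_eq_iff)
  then show "\<forall>z. MDDO M X Y z = 0" by (simp add: MDDO_eq_integral)
qed

section \<open>Behaviour under bounded linear maps\<close>

lemma mean_zero_pair_bounded_linear:
  fixes S :: "'h \<Rightarrow> 'k::{real_inner,banach,second_countable_topology}"
  assumes S: "bounded_linear S"
  shows "mean_zero_pair M (\<lambda>\<omega>. S (X \<omega>)) Y"
proof
  show "integrable M (\<lambda>\<omega>. S (X \<omega>))" by (rule integrable_bounded_linear[OF S integrable_X])
  then have [measurable]: "(\<lambda>\<omega>. S (X \<omega>)) \<in> borel_measurable M" by auto
  show "(LINT \<omega>|M. S (X \<omega>)) = 0"
    using integral_bounded_linear[OF S integrable_X] by (simp add: mean_zero linear_simps[OF S])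
  obtain K where K: "\<And>x. norm (S x) \<le> norm x * K" "K \<ge> 0"
    using bounded_linear.nonneg_bounded[OF S] by blast
  show "integrable M (\<lambda>\<omega>. norm (S (X \<omega>)) * norm (Y \<omega>))"
  proof (rule Bochner_Integration.integrable_bound)
    show "integrable M (\<lambda>\<omega>. K * (norm (X \<omega>) * norm (Y \<omega>)))" using integrable_XY by simp
    have "norm (S (X \<omega>)) * norm (Y \<omega>) \<le> (norm (X \<omega>) * K) * norm (Y \<omega>)" for \<omega>
      by (intro mult_right_mono K) simp
    then show "AE \<omega> in M. norm (norm (S (X \<omega>)) * norm (Y \<omega>)) \<le> norm (K * (norm (X \<omega>) * norm (Y \<omega>)))"
      using K(2) by (simp add: abs_mult ac_simps)
  qed measurable
qed measurable

lemma G_fun_bounded_linear: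
  fixes S :: "'h \<Rightarrow> 'k::{real_inner,banach,second_countable_topology}"
  assumes S: "bounded_linear S"
  shows "G_fun M (\<lambda>\<omega>. S (X \<omega>)) Y s = map_prod S S (G_fun M X Y s)"
proof -
  interpret S: mean_zero_pair M "\<lambda>\<omega>. S (X \<omega>)" Y
    by (rule mean_zero_pair_bounded_linear[OF S])
  have "(LINT \<omega>|M. f (s \<bullet> Y \<omega>) *\<^sub>R S (X \<omega>)) = S (LINT \<omega>|M. f (s \<bullet> Y \<omega>) *\<^sub>R X \<omega>)"
    if "f \<in> borel_measurable borel" "\<And>t. \<bar>f t\<bar> \<le> 1" for f
    using integral_bounded_linear[OF S integrable_scaleR_X[OF that], of s] by (simp add: linear_simps[OF S])
  from this[of cos] this[of "\<lambda>t. - sin t"] show ?thesis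
    by (simp add: G_fun_eq S.G_fun_eq)
qed

text \<open>\<open>S\<close> acts on both factors of the tensor. On the vector factor it is pulled
  out of the integral; in the scalar coefficient it moves to the argument by adjointness and turns
  \<open>z\<close> into \<open>T z\<close>.\<close>

lemma MDDO_bounded_linear:
  fixes S :: "'h \<Rightarrow> 'k::{real_inner,banach,second_countable_topology}"
  assumes S: "bounded_linear S" and adj: "\<And>x. S x \<bullet> z = x \<bullet> T z"
  shows "MDDO M (\<lambda>\<omega>. S (X \<omega>)) Y z = map_prod S S (MDDO M X Y (T z))"
proof -
  interpret S: mean_zero_pair M "\<lambda>\<omega>. S (X \<omega>)" Y
    by (rule mean_zero_pair_bounded_linear[OF S])
  have lin: "bounded_linear (map_prod S S)"
  proof -
    have "bounded_linear (\<lambda>p. (S (fst p), S (snd p)))"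
      by (intro bounded_linear_Pair bounded_linear_compose[OF S] bounded_linear_fst bounded_linear_snd)
    then show ?thesis by (simp add: map_prod_def case_prod_beta')
  qed
  have "S.mddo_integrand z = (\<lambda>s. map_prod S S (mddo_integrand (T z) s))"
    unfolding fun_eq_iff S.mddo_integrand_def mddo_integrand_def G_fun_bounded_linear[OF S]
    by (simp add: tensor_HC_def conj_HC_def Let_def adj linear_simps[OF S] map_prod_def case_prod_beta')
  then have "integral\<^sup>L lborel (S.mddo_integrand z) = map_prod S S (integral\<^sup>L lborel (mddo_integrand (T z)))"
    using integral_bounded_linear[OF lin integrable_mddo_integrand, of "T z"] by simp
  then show ?thesis
    by (simp add: S.MDDO_eq_integral MDDO_eq_integral linear_simps[OF lin])
qed

end

theorem theorem2p1:
  fixes M :: "'a measure"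
    and X :: "'a \<Rightarrow> 'h::{real_inner,banach,second_countable_topology}"
    and Y :: "'a \<Rightarrow> real ^ 'q"
  assumes H_is_L2: "\<exists>U :: 'h \<Rightarrow> real \<Rightarrow> real. L2_01_model U"
    and P: "prob_space M"
    and Xm: "X \<in> borel_measurable M"
    and Ym: "Y \<in> borel_measurable M"
    and mom: "integrable M (\<lambda>\<omega>. (norm (X \<omega>))^2 + (norm (Y \<omega>))^2)"
    and mean0: "integral\<^sup>L M X = 0"
  shows "((\<forall>z. MDDO M X Y z = 0) \<longleftrightarrow> cond_exp_zero_ae M X Y)
       \<and> (\<forall>T :: 'h \<Rightarrow> 'h. bounded_linear T \<longrightarrow>
            (\<forall>z. MDDO M (\<lambda>\<omega>. adjoint T (X \<omega>)) Y z =
                 map_prod (adjoint T) (adjoint T) (MDDO M X Y (T z))))"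
proof -
  interpret prob_space M by (rule P)
  note [measurable] = Xm Ym
  interpret mean_zero_pair M X Y
  proof
    show "integrable M X"
    proof (rule Bochner_Integration.integrable_bound)
      show "integrable M (\<lambda>\<omega>. 1 + ((norm (X \<omega>))^2 + (norm (Y \<omega>))^2))" using mom by simp
      have "x \<le> 1 + (x\<^sup>2 + y\<^sup>2)" for x y :: real
      proof -
        \<comment> \<open>The square of x - 1/2 already gives x <= x^2 + 1/4.\<close>
        have "x \<le> 1 + x\<^sup>2"
          using zero_le_power2[of "x - 1/2"] by (simp add: power2_eq_square algebra_simps)
        then show ?thesis using zero_le_power2[of y] by linarith
      qed
      then show "AE \<omega> in M. norm (X \<omega>) \<le> norm (1 + ((norm (X \<omega>))^2 + (norm (Y \<omega>))^2))"
        by (auto intro!: AE_I2 order_trans[OF _ abs_ge_self])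
    qed measurable
    show "integrable M (\<lambda>\<omega>. norm (X \<omega>) * norm (Y \<omega>))"
    proof (rule Bochner_Integration.integrable_bound[OF mom])
      have "x * y \<le> x\<^sup>2 + y\<^sup>2" if "0 \<le> x" "0 \<le> y" for x y :: real
        using sum_squares_bound[of x y] mult_nonneg_nonneg[OF that] by linarith
      then show "AE \<omega> in M. norm (norm (X \<omega>) * norm (Y \<omega>)) \<le> norm ((norm (X \<omega>))^2 + (norm (Y \<omega>))^2)"
        by simp
    qed measurable
  qed (use Ym mean0 in auto)
  have "MDDO M (\<lambda>\<omega>. adjoint T (X \<omega>)) Y z = map_prod (adjoint T) (adjoint T) (MDDO M X Y (T z))"
    if "bounded_linear T" for T :: "'h \<Rightarrow> 'h" and z
  \<comment> \<open>The bounded map is now \<open>adjoint T\<close>, so the operator adjoint to it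
    in the required sense is \<open>T\<close>.\<close>
  proof (rule MDDO_bounded_linear[OF bounded_linear_adjoint[OF that]])
    show "adjoint T x \<bullet> z = x \<bullet> T z" for x
      using bounded_linear_adjoint_inner[OF that, of z x] by (simp add: inner_commute)
  qed
  then show ?thesis using MDDO_zero_iff by blast
qed

end
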